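(* Let $m$ and $n$ be positive integers with $n\geq 2m$, and let $s:=\lfloor\log_2(n/m)\rfloor$. For any ordered collection of matrices $$(\boldsymbol{M}_1,\ldots,\boldsymbol{M}_s)\in\left\{\begin{bmatrix}1&0\\1&1\end{bmatrix},\begin{bmatrix}0&1\\-1&2\end{bmatrix}\right\}^s$$ the map $$\mathcal{F}_m\to\mathcal{F}_n,\qquad \begin{bmatrix}h\\k\end{bmatrix}\mapsto\prod_{i=1}^{s}\boldsymbol{M}_{s-i+1}\cdot\begin{bmatrix}h\\k\end{bmatrix}=\boldsymbol{M}_s\boldsymbol{M}_{s-1}\cdots\boldsymbol{M}_1\cdot\begin{bmatrix}h\\k\end{bmatrix},$$ is well defined (its values lie in $\mathcal{F}_n$), order-preserving and injective. Moreover, all of its values are fractions $\leq\frac12$ if $\boldsymbol{M}_s=\begin{bmatrix}1&0\\1&1\end{bmatrix}$, and all of its values are fractions $\geq\frac12$ if $\boldsymbol{M}_s=\begin{bmatrix}0&1\\-1&2\end{bmatrix}$.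
   Context: For a positive integer $n$, the Farey sequence $\mathcal{F}_n$ of order $n$ is the increasing sequence of all irreducible fractions $\frac{h}{k}$ with $0\leq h\leq k\leq n$, $k\geq 1$, $\gcd(h,k)=1$; it includes $\frac{0}{1}$ and $\frac{1}{1}$. The irreducible fraction $\frac{h}{k}$ is identified with the column vector $\begin{bmatrix}h\\k\end{bmatrix}$, and the order on vectors is the usual order on the corresponding fractions. *)

theory Defs
  imports "HOL-Analysis.Analysis"
begin

text \<open>
  The irreducible fraction \<open>h / k\<close> is the column vector with entries \<open>h\<close> and \<open>k\<close>.
\<close>

definition frac_of :: "int ^ 2 \<Rightarrow> rat" where
  "frac_of v = of_int (v $ 1) / of_int (v $ 2)"

text \<open>
  This order, rather than the componentwise order that the library puts on \<open>int ^ 2\<close>,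
  is the one meant for Farey fractions.  It is antisymmetric only on reduced vectors
  such as those in \<open>farey n\<close>.
\<close>

definition frac_le :: "int ^ 2 \<Rightarrow> int ^ 2 \<Rightarrow> bool" where
  "frac_le v w \<longleftrightarrow> frac_of v \<le> frac_of w"

text \<open>
  The Farey sequence of order \<open>n\<close> as the set of its members; being increasing, the
  sequence is determined by this set together with \<open>frac_le\<close>.
\<close>

definition farey :: "nat \<Rightarrow> (int ^ 2) set" where
  "farey n = {v. 0 \<le> v $ 1 \<and> v $ 1 \<le> v $ 2 \<and> v $ 2 \<le> int n \<and> 1 \<le> v $ 2
                \<and> coprime (v $ 1) (v $ 2)}"

text \<open>Matrices are given by their rows.\<close>

definition mat_L :: "int ^ 2 ^ 2" where
  "mat_L = vector [vector [1, 0], vector [1, 1]]"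

definition mat_R :: "int ^ 2 ^ 2" where
  "mat_R = vector [vector [0, 1], vector [- 1, 2]]"

text \<open>\<open>left_prod M s\<close> is the product \<open>M s ** \<dots> ** M 2 ** M 1\<close>.\<close>

primrec left_prod :: "(nat \<Rightarrow> int ^ 2 ^ 2) \<Rightarrow> nat \<Rightarrow> int ^ 2 ^ 2" where
  "left_prod M 0 = mat 1"
| "left_prod M (Suc i) = M (Suc i) ** left_prod M i"

end

theory Submission
  imports Defs
begin

text \<open>
  Both matrices send \<open>h / k\<close> to a fraction with denominator at most \<open>2 k\<close>, so each factor at most
  doubles the order, and \<open>2\<^sup>s m \<le> n\<close>. They have determinant \<open>1\<close>, hence preserve reduced fractions
  and their order; the last factor decides on which side of \<open>1 / 2\<close> the values lie.
\<close>

lemma mat_L_mult_nth [simp]: "(mat_L *v v) $ 1 = v $ 1" "(mat_L *v v) $ 2 = v $ 1 + v $ 2"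
  by (simp_all add: mat_L_def matrix_vector_mult_def sum_2)

lemma mat_R_mult_nth [simp]: "(mat_R *v v) $ 1 = v $ 2" "(mat_R *v v) $ 2 = 2 * v $ 2 - v $ 1"
  by (simp_all add: mat_R_def matrix_vector_mult_def sum_2)

lemma inj_mat_L_mult: "inj ((*v) mat_L)"
  by (rule injI) (simp add: vec_eq_iff forall_2)

lemma inj_mat_R_mult: "inj ((*v) mat_R)"
  by (rule injI) (simp add: vec_eq_iff forall_2)

text \<open>With positive denominators, the order is the sign of the determinant of the matrix with
  columns \<open>v\<close> and \<open>w\<close>, which multiplication by a matrix of determinant 1
  preserves.\<close>

lemma frac_le_iff:
  assumes "v $ 2 > 0" "w $ 2 > 0"
  shows "frac_le v w \<longleftrightarrow> v $ 1 * w $ 2 \<le> w $ 1 * v $ 2"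
proof -
  have "frac_le v w \<longleftrightarrow> (of_int (v $ 1 * w $ 2) :: rat) \<le> of_int (w $ 1 * v $ 2)"
    using assms by (simp add: frac_le_def frac_of_def divide_simps)
  then show ?thesis
    by (simp only: of_int_le_iff)
qed

lemma farey_mono: "a \<le> b \<Longrightarrow> farey a \<subseteq> farey b"
  by (auto simp: farey_def)

lemma mat_L_mult_farey: "v \<in> farey a \<Longrightarrow> mat_L *v v \<in> farey (2 * a)"
  by (auto simp: farey_def coprime_iff_gcd_eq_1)

text \<open>For \<open>v\<close> = h / k, the bounds 0 \<le> h \<le> k give k \<le> 2k - h \<le> 2k,
  so the image k / (2k - h) is at most 1 and its denominator at most doubles.\<close>

lemma mat_R_mult_farey:
  assumes "v \<in> farey a"
  shows "mat_R *v v \<in> farey (2 * a)"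
proof -
  have "coprime (v $ 2) (2 * v $ 2 - v $ 1)"
  proof (rule coprimeI)
    fix c assume c: "c dvd v $ 2" "c dvd 2 * v $ 2 - v $ 1"
    \<comment> \<open>This difference recovers the old numerator, so \<open>c\<close> is a common
      divisor of the original reduced pair.\<close>
    have "c dvd 2 * v $ 2 - (2 * v $ 2 - v $ 1)"
      by (rule dvd_diff[OF dvd_mult[OF c(1)] c(2)])
    then have "c dvd v $ 1"
      by simp
    moreover have "coprime (v $ 1) (v $ 2)"
      using assms by (simp add: farey_def)
    ultimately show "is_unit c"
      using c(1) by (meson coprime_common_divisor)
  qed
  with assms show ?thesis
    by (auto simp: farey_def)
qed

lemma mat_L_mult_mono: "monotone_on (farey a) frac_le frac_le ((*v) mat_L)"
  by (rule monotone_onI) (auto simp: farey_def frac_le_iff algebra_simps)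

lemma mat_R_mult_mono: "monotone_on (farey a) frac_le frac_le ((*v) mat_R)"
  by (rule monotone_onI) (auto simp: farey_def frac_le_iff algebra_simps)

text \<open>The image is h / (h + k), and 2h \<le> h + k because h \<le> k.\<close>

lemma frac_of_mat_L_mult_le:
  assumes "v \<in> farey a"
  shows "frac_of (mat_L *v v) \<le> 1 / 2"
proof -
  have "0 < v $ 1 + v $ 2" "2 * v $ 1 \<le> v $ 1 + v $ 2"
    using assms by (auto simp: farey_def)
  then have "(0::rat) < of_int (v $ 1 + v $ 2)" "(of_int (2 * v $ 1)::rat) \<le> of_int (v $ 1 + v $ 2)"
    by (simp_all only: of_int_0_less_iff of_int_le_iff)
  then show ?thesis
    by (simp add: frac_of_def divide_simps)
qed

text \<open>The image is k / (2k - h), and 2k - h \<le> 2k because 0 \<le> h.\<close>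

lemma frac_of_mat_R_mult_ge:
  assumes "v \<in> farey a"
  shows "1 / 2 \<le> frac_of (mat_R *v v)"
proof -
  have "0 < 2 * v $ 2 - v $ 1" "2 * v $ 2 - v $ 1 \<le> 2 * v $ 2"
    using assms by (auto simp: farey_def)
  then have "(0::rat) < of_int (2 * v $ 2 - v $ 1)"
    "(of_int (2 * v $ 2 - v $ 1)::rat) \<le> of_int (2 * v $ 2)"
    by (simp_all only: of_int_0_less_iff of_int_le_iff)
  then show ?thesis
    by (simp add: frac_of_def divide_simps)
qed

text \<open>The three claims share one induction: composing monotone maps requires the image under
  the first \<open>s\<close> factors to lie in a Farey set, where the next factor is monotone. The
  order \<open>2 ^ s * m\<close> records one doubling per factor.\<close>

lemma left_prod_mult_farey:
  assumes "\<forall>i\<in>{1..s}. M i \<in> {mat_L, mat_R}"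
  shows "(\<lambda>v. left_prod M s *v v) ` farey m \<subseteq> farey (2 ^ s * m)"
    and "monotone_on (farey m) frac_le frac_le (\<lambda>v. left_prod M s *v v)"
    and "inj_on (\<lambda>v. left_prod M s *v v) (farey m)"
  using assms
proof (induction s)
  case 0
  { case 1 show ?case by simp }
  { case 2 show ?case by (simp add: monotone_on_def) }
  { case 3 show ?case by simp }
next
  case (Suc s)
  let ?f = "\<lambda>v. left_prod M s *v v"
  have step: "(\<lambda>v. left_prod M (Suc s) *v v) = (*v) (M (Suc s)) \<circ> ?f"
    by (simp add: fun_eq_iff matrix_vector_mul_assoc)
  \<comment> \<open>The condition on the factors stays a premise here, because each of the three
    cases below supplies it separately.\<close>
  have IH: "?f ` farey m \<subseteq> farey (2 ^ s * m)" "monotone_on (farey m) frac_le frac_le ?f"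
      "inj_on ?f (farey m)"
    and last: "M (Suc s) \<in> {mat_L, mat_R}"
    if "\<forall>i\<in>{1..Suc s}. M i \<in> {mat_L, mat_R}"
    using Suc.IH that by auto
  { case 1
    from IH(1)[OF 1] last[OF 1] show ?case
      using mat_L_mult_farey[of _ "2 ^ s * m"] mat_R_mult_farey[of _ "2 ^ s * m"]
      unfolding step by (auto simp: mult.assoc image_subset_iff) }
  { case 2
    from last[OF 2] have "monotone_on (farey (2 ^ s * m)) frac_le frac_le ((*v) (M (Suc s)))"
      using mat_L_mult_mono mat_R_mult_mono by auto
    from monotone_on_o[OF this IH(2)[OF 2] IH(1)[OF 2]] show ?case
      unfolding step . }
  { case 3
    from last[OF 3] have "inj ((*v) (M (Suc s)))"
      using inj_mat_L_mult inj_mat_R_mult by auto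
    then show ?case
      unfolding step using IH(3)[OF 3] by (blast intro: comp_inj_on inj_on_subset) }
qed

lemma power_floor_log_mult_le:
  fixes m n s :: nat
  assumes "m \<ge> 1" "n \<ge> 1" "int s = \<lfloor>log 2 (real n / real m)\<rfloor>"
  shows "2 ^ s * m \<le> n"
proof -
  have "real s \<le> log 2 (real n / real m)"
    using assms(3) by linarith
  then have "2 ^ s \<le> real n / real m"
    using assms(1,2) by (simp add: le_log_iff powr_realpow)
  then have "real (2 ^ s * m) \<le> real n"
    using assms(1) by (simp add: field_simps)
  then show ?thesis
    by (simp only: of_nat_le_iff)
qed

theorem lemma8:
  fixes m n s :: nat
    and M :: "nat \<Rightarrow> int ^ 2 ^ 2"
    and \<phi> :: "int ^ 2 \<Rightarrow> int ^ 2"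
  assumes "m \<ge> 1" and "n \<ge> 1" and "n \<ge> 2 * m"
    and "int s = \<lfloor>log 2 (real n / real m)\<rfloor>"
    and "\<forall>i\<in>{1..s}. M i \<in> {mat_L, mat_R}"
  defines "\<phi> \<equiv> (\<lambda>v. left_prod M s *v v)"
  shows "\<phi> ` farey m \<subseteq> farey n
    \<and> monotone_on (farey m) frac_le frac_le \<phi>
    \<and> inj_on \<phi> (farey m)
    \<and> (M s = mat_L \<longrightarrow> (\<forall>v\<in>farey m. frac_of (\<phi> v) \<le> 1 / 2))
    \<and> (M s = mat_R \<longrightarrow> (\<forall>v\<in>farey m. frac_of (\<phi> v) \<ge> 1 / 2))"
proof -
  note prod = left_prod_mult_farey[OF assms(5), of m, folded \<phi>_def]
  have range: "\<phi> ` farey m \<subseteq> farey n"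
    using prod(1) farey_mono[OF power_floor_log_mult_le[OF assms(1,2,4)]] by blast
  \<comment> \<open>From \<open>n \<ge> 2 * m\<close> follows \<open>s \<ge> 1\<close>, so
    \<open>M s\<close> really is a factor of the product.\<close>
  have "log 2 2 \<le> log 2 (real n / real m)"
    using assms(1-3) by (simp add: field_simps flip: of_nat_mult)
  then have "int s \<ge> 1"
    unfolding assms(4) by (simp add: le_floor_iff)
  then obtain r where r: "s = Suc r"
    by (cases s) auto
  \<comment> \<open>Splitting off the outermost factor leaves it acting on a vector of a Farey set,
    to which the bounds by 1/2 apply.\<close>
  have \<phi>: "\<phi> v = M s *v (left_prod M r *v v)" for v
    by (simp add: \<phi>_def r matrix_vector_mul_assoc)
  have prev: "left_prod M r *v v \<in> farey (2 ^ r * m)" if "v \<in> farey m" for v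
    using left_prod_mult_farey(1)[of r M m] assms(5) that r by auto
  have "\<forall>v\<in>farey m. frac_of (\<phi> v) \<le> 1 / 2" if "M s = mat_L"
    using prev unfolding \<phi> that by (blast intro: frac_of_mat_L_mult_le)
  moreover have "\<forall>v\<in>farey m. 1 / 2 \<le> frac_of (\<phi> v)" if "M s = mat_R"
    using prev unfolding \<phi> that by (blast intro: frac_of_mat_R_mult_ge)
  ultimately show ?thesis
    using range prod(2,3) by blast
qed

end
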